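(* Let $k$ be any positive integer. Then the Diophantine equation $$(20k)^x+(99k)^y=(101k)^z$$ in positive integers $x,y,z$ has only the solution $(x,y,z)=(2,2,2)$. *)

theory Defs
  imports Main
begin

end

theory Submission
  imports Defs "HOL-Number_Theory.Cong" "HOL-Computational_Algebra.Primes"
begin

text \<open>
  If \<open>z \<ge> max x y\<close>, comparing sizes leaves only \<open>x = y = z = 2\<close>. Otherwise cancel common powers of
  \<open>k\<close>. For \<open>x \<le> z < y\<close> the number \<open>k ^ (z - x)\<close> divides \<open>20 ^ x\<close> with a coprime cofactor
  \<open>w \<in> {1, 4 ^ x, 5 ^ x, 20 ^ x}\<close>, and \<open>w + 99 ^ y * M = 101 ^ z\<close>. Congruences modulo 11 and 3 make
  \<open>w\<close> and \<open>101 ^ z\<close> squares \<open>D\<^sup>2\<close> and \<open>C\<^sup>2\<close>. Then \<open>11 ^ y\<close> divides one of \<open>C - D\<close> and \<open>C + D\<close>,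
  which is impossible for \<open>y > z\<close> because \<open>121 > 101\<close>. For \<open>y \<le> z < x\<close> one likewise gets
  \<open>w + 20 ^ x * N = 101 ^ z\<close> with \<open>w \<in> {1, 9 ^ y, 11 ^ y, 99 ^ y}\<close>. When \<open>w = D\<^sup>2\<close> with
  \<open>D \<equiv> 1 (mod 20)\<close>, all of \<open>20 ^ x\<close> divides \<open>2 * (C - D)\<close>, which is too small; for \<open>w = 9 ^ y\<close>
  and \<open>w = 11 ^ y\<close> the remaining sign of \<open>D\<close> modulo 4 or 5 is settled by congruences and by
  \<open>4 ^ x < 5 ^ x\<close>. If \<open>z < min x y\<close>, cancelling leaves a factor that is a power of 101. For
  \<open>x \<le> y\<close> it has the first shape with \<open>w = 20 ^ x\<close>; for \<open>y < x\<close> either \<open>k = 1\<close>, which is the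
  second shape with \<open>w = 99 ^ y\<close>, or 101 would divide \<open>99 ^ y\<close>.
\<close>

section \<open>Squares, periodicity of powers and parity of exponents\<close>

lemma square_add_eq_square:
  fixes C D T :: int
  assumes "D\<^sup>2 + T = C\<^sup>2" "T > 0" "C > 0"
  shows "T = (C - D) * (C + D)" "\<bar>D\<bar> < C"
proof -
  show "T = (C - D) * (C + D)"
    using assms(1) by (simp add: power2_eq_square algebra_simps)
  have "\<bar>D\<bar>\<^sup>2 < C\<^sup>2"
    using assms by simp
  then show "\<bar>D\<bar> < C"
    by (rule power_less_imp_less_base) (use \<open>C > 0\<close> in simp)
qed

lemma cong_if_add_multiple:
  fixes v w t m :: int
  assumes "w + t = v" "m dvd t"
  shows "[w = v] (mod m)"
  using assms by (auto simp: cong_iff_dvd_diff simp flip: assms(1))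

lemma cong_power_periodic:
  fixes a m :: int
  assumes "[a ^ p = 1] (mod m)"
  shows "[a ^ (p * i + r) = a ^ r] (mod m)"
proof -
  have "[(a ^ p) ^ i * a ^ r = 1 ^ i * a ^ r] (mod m)"
    using assms by (intro cong_mult cong_pow cong_refl)
  then show ?thesis
    by (simp add: power_add power_mult)
qed

lemma even_exponent_if_order_two:
  fixes a m :: int
  assumes "[a\<^sup>2 = 1] (mod m)" "\<not> [a = 1] (mod m)" "[a ^ n = 1] (mod m)"
  shows "even n"
proof (rule ccontr)
  assume "odd n"
  then obtain j where "n = 2 * j + 1"
    by (elim oddE)
  then have "[a ^ n = a] (mod m)"
    using cong_power_periodic [OF assms(1), of j 1] by simp
  with assms show False
    by (metis cong_sym cong_trans)
qed

text \<open>By Euler's criterion the fifth power modulo 11 is the Legendre symbol. It is 1 for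
  \<open>u\<close>, whereas 101 \<equiv> 2 is a non-residue with fifth power -1.\<close>

lemma even_exponent_if_quadratic_residue:
  fixes u :: int
  assumes "[u ^ 5 = 1] (mod 11)" and "[u ^ x = 101 ^ z] (mod 11)"
  shows "even z"
proof (rule ccontr)
  assume "odd z"
  have "[(u ^ 5) ^ x = 1 ^ x] (mod 11)"
    using assms(1) by (rule cong_pow)
  moreover have "[(u ^ x) ^ 5 = (101 ^ z) ^ 5] (mod 11)"
    using assms(2) by (rule cong_pow)
  moreover have "(u ^ x) ^ 5 = (u ^ 5) ^ x" "(101 ^ z) ^ 5 = ((101::int) ^ 5) ^ z"
    by (simp_all only: power_mult [symmetric] mult.commute)
  moreover have "[((101::int) ^ 5) ^ z = (- 1) ^ z] (mod 11)"
    by (rule cong_pow) (simp add: cong_def)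
  ultimately have "[1 = (- 1) ^ z] (mod (11::int))"
    by (metis cong_sym cong_trans power_one)
  with \<open>odd z\<close> show False
    by (simp add: cong_def)
qed

section \<open>Size bounds from differences of squares\<close>

text \<open>If 11 divided both \<open>C - D\<close> and \<open>C + D\<close>, it would divide
  \<open>2 * D\<close>. So \<open>11 ^ y\<close> divides one of them and is at most
  \<open>2 * C\<close>, yet it is at least 11 * 121^Z.\<close>

lemma difference_of_squares_11:
  fixes D M :: int
  assumes eq: "D\<^sup>2 + 11 ^ y * M = 101 ^ (2 * Z)"
    and "M > 0" and D: "\<not> 11 dvd D" and "2 * Z < y"
  shows False
proof -
  define C :: int where "C = 101 ^ Z"
  have "C > 0"
    by (simp add: C_def)
  moreover have "D\<^sup>2 + 11 ^ y * M = C\<^sup>2"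
    using eq by (simp add: C_def mult.commute flip: power_mult)
  ultimately have eq': "11 ^ y * M = (C - D) * (C + D)" and abs: "\<bar>D\<bar> < C"
    using square_add_eq_square \<open>M > 0\<close> by simp_all
  have p: "prime (11::int)"
    by simp
  have "\<not> (11 dvd C - D \<and> 11 dvd C + D)"
  proof
    assume "11 dvd C - D \<and> 11 dvd C + D"
    then have "11 dvd (C + D) - (C - D)"
      by (meson dvd_diff)
    then have "11 dvd 2 * D"
      by simp
    with D p show False
      by (simp add: prime_dvd_mult_iff)
  qed
  then have "coprime (11 ^ y) (C - D) \<or> coprime (11 ^ y) (C + D)"
    using p by (metis coprime_power_left_iff prime_imp_coprime)
  moreover have "11 ^ y dvd (C - D) * (C + D)"
    using eq' by (metis dvd_triv_left)
  ultimately have "11 ^ y dvd C - D \<or> 11 ^ y dvd C + D"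
    by (metis coprime_dvd_mult_left_iff coprime_dvd_mult_right_iff)
  then have "11 ^ y \<le> 2 * C"
    using abs zdvd_imp_le by fastforce
  moreover have "11 * C \<le> 11 * 11 ^ (2 * Z)"
    unfolding C_def power_mult by (simp add: power_mono)
  moreover have "11 * 11 ^ (2 * Z) \<le> (11::int) ^ y"
    using \<open>2 * Z < y\<close> power_increasing [of "Suc (2 * Z)" y "11::int"] by simp
  ultimately show False
    using \<open>C > 0\<close> by linarith
qed

text \<open>Since \<open>C\<close> and \<open>D\<close> are both 1 modulo 20, half of
  \<open>C + D\<close> is coprime to 20. So \<open>20 ^ x\<close> divides
  \<open>2 * (C - D)\<close>, which is less than \<open>4 * C\<close>, yet it is at least 20 *
  400^Z.\<close>

lemma difference_of_squares_20:
  fixes D M :: int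
  assumes eq: "D\<^sup>2 + 20 ^ x * M = 101 ^ (2 * Z)"
    and "M > 0" and D: "[D = 1] (mod 20)" and "2 * Z < x"
  shows False
proof -
  define C :: int where "C = 101 ^ Z"
  have "C > 0"
    by (simp add: C_def)
  moreover have "D\<^sup>2 + 20 ^ x * M = C\<^sup>2"
    using eq by (simp add: C_def mult.commute flip: power_mult)
  ultimately have eq': "20 ^ x * M = (C - D) * (C + D)" and abs: "\<bar>D\<bar> < C"
    using square_add_eq_square \<open>M > 0\<close> by simp_all
  have "[C = 1 ^ Z] (mod 20)"
    unfolding C_def by (rule cong_pow) (simp add: cong_def)
  then have "[C + D = 1 ^ Z + 1] (mod 20)"
    using D by (rule cong_add)
  then have "(C + D) mod 20 = 2"
    by (simp add: cong_def)
  define P where "P = 10 * ((C + D) div 20) + 1"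
  have P: "C + D = 2 * P" "P mod 10 = 1"
    using \<open>(C + D) mod 20 = 2\<close> div_mult_mod_eq [of "C + D" 20] by (simp_all add: P_def)
  have "coprime P 10"
    using P(2) by (metis coprime_mod_left_iff coprime_1_left zero_neq_numeral)
  then have "coprime P (10 ^ 2)"
    by (simp only: coprime_power_right_iff) simp
  then have "coprime P 20"
    by (rule coprime_divisors [rotated 2]) simp_all
  then have "coprime (20 ^ x) P"
    by (simp add: coprime_commute)
  moreover have "20 ^ x dvd (2 * (C - D)) * P"
    using eq' P(1) by (metis dvd_triv_left mult.assoc mult.commute)
  ultimately have "20 ^ x dvd 2 * (C - D)"
    by (simp add: coprime_dvd_mult_left_iff)
  then have "20 ^ x \<le> 4 * C"
    using abs zdvd_imp_le by fastforce
  moreover have "20 * C \<le> 20 * 20 ^ (2 * Z)"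
    unfolding C_def power_mult by (simp add: power_mono)
  moreover have "20 * 20 ^ (2 * Z) \<le> (20::int) ^ x"
    using \<open>2 * Z < x\<close> power_increasing [of "Suc (2 * Z)" x "20::int"] by simp
  ultimately show False
    using \<open>C > 0\<close> by linarith
qed

section \<open>The reduced equation with \<open>99 ^ y\<close> and \<open>z < y\<close>\<close>

lemma no_solution_y_gt_z:
  fixes w M :: int
  assumes w: "w \<in> {1, 4 ^ x, 5 ^ x, 20 ^ x}" and eq: "w + 99 ^ y * M = 101 ^ z"
    and "M > 0" and "z < y"
  shows False
proof -
  have dvd: "11 dvd (99::int) ^ y" "3 dvd (99::int) ^ y"
    using \<open>z < y\<close> by (auto intro: dvd_power_le [of _ _ 1, simplified])
  have w11: "[w = 101 ^ z] (mod 11)" and w3: "[w = 101 ^ z] (mod 3)"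
    using cong_if_add_multiple [OF eq] dvd by (simp_all add: dvd_mult2)
  have "\<exists>u::int. w = u ^ x \<and> u \<in> {1, 4, 5, 20}"
    using w by (metis insert_iff power_one empty_iff)
  then obtain u :: int where u: "w = u ^ x" "u \<in> {1, 4, 5, 20}"
    by blast
  \<comment> \<open>1, 4, 5 \<equiv> 4^2 and 20 \<equiv> 3^2 are all quadratic residues modulo
    11.\<close>
  have "[u ^ 5 = 1] (mod 11)"
    using u(2) by (auto simp: cong_def)
  then have "even z"
    using w11 unfolding u(1) by (rule even_exponent_if_quadratic_residue)
  then obtain Z where Z: "z = 2 * Z" by blast
  have "\<exists>D. w = D\<^sup>2"
  proof (cases "u \<in> {5, 20}")
    case True
    \<comment> \<open>5, 20 and 101 are all -1 modulo 3, so \<open>x\<close> has the parity of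
      \<open>z\<close>.\<close>
    have "[101 ^ z = (- 1) ^ z] (mod (3::int))"
      by (rule cong_pow) (simp add: cong_def)
    moreover have "[u ^ x = (- 1) ^ x] (mod 3)"
      using True by (intro cong_pow) (auto simp: cong_def)
    ultimately have "[(- 1) ^ x = (- 1) ^ z] (mod (3::int))"
      using w3 u(1) by (metis cong_sym cong_trans)
    with \<open>even z\<close> have "even x"
      by (cases "even x") (auto simp: cong_def)
    then show ?thesis
      using u(1) by (metis evenE power_mult mult.commute)
  next
    case False
    with u(2) have "w = 1\<^sup>2 \<or> w = (2 ^ x)\<^sup>2"
      unfolding u(1) by (auto simp flip: power_mult_distrib simp: power2_eq_square)
    then show ?thesis by blast
  qed
  then obtain D where D: "w = D\<^sup>2" by blast
  have "\<not> 11 dvd D"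
  proof
    assume "11 dvd D"
    then have "11 dvd u ^ x"
      using D u(1) by (simp add: power2_eq_square)
    then have "11 dvd u"
      using prime_dvd_power [of "11::int"] by simp
    with u(2) show False by auto
  qed
  moreover have "D\<^sup>2 + 11 ^ y * (9 ^ y * M) = 101 ^ (2 * Z)"
    using eq D Z by (simp add: mult.assoc [symmetric] flip: power_mult_distrib)
  ultimately show False
    using difference_of_squares_11 [of D y "9 ^ y * M" Z] \<open>M > 0\<close> \<open>z < y\<close> Z by simp
qed

section \<open>Coprime factorizations of a product of two prime powers\<close>

text \<open>Each prime power is coprime to \<open>w\<close> or to \<open>K\<close>, hence goes
  entirely into the other factor. The four choices give the four values.\<close>

lemma coprime_factors_of_two_prime_powers:
  fixes p q w K :: nat
  assumes "prime p" "prime q" and eq: "w * K = p ^ m * q ^ n" and "coprime w K"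
  shows "w = 1 \<or> w = p ^ m \<or> w = q ^ n \<or> w = p ^ m * q ^ n"
proof -
  have split: "coprime (r ^ i) w \<or> coprime (r ^ i) K" if "prime r" for r i
    using that \<open>coprime w K\<close>
    by (metis coprime_common_divisor_nat coprime_power_left_iff not_prime_1 prime_imp_coprime)
  have half: "w = s" if "w * K = r * s" "coprime r w" "coprime s K" for r s
    using that
    by (metis coprime_commute coprime_dvd_mult_left_iff coprime_dvd_mult_right_iff
        dvd_antisym dvd_triv_left dvd_triv_right)
  show ?thesis
    using split [OF assms(1), of m] split [OF assms(2), of n]
      half [of "p ^ m" "q ^ n"] half [of "q ^ n" "p ^ m"]
      half [of "p ^ m * q ^ n" 1] half [of 1 "p ^ m * q ^ n"] eq
    by (auto simp: mult.commute)
qed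

section \<open>The reduced equations with \<open>20 ^ x\<close> and \<open>z < x\<close>\<close>

lemma no_solution_w_1:
  fixes N :: int
  assumes eq: "1 + 20 ^ x * N = 101 ^ z" and "N > 0" "0 < z" "z < x"
  shows False
proof -
  \<comment> \<open>\<open>x \<ge> 2\<close> makes modulus 8 available, where 101 \<equiv> 5 has
    order two; modulo 4 it is just 1.\<close>
  have "(20::int) ^ 2 dvd 20 ^ x"
    using assms by (intro le_imp_power_dvd) simp
  then have "8 dvd (20::int) ^ x"
    by (rule dvd_trans [rotated]) simp
  then have "[101 ^ z = 1] (mod (8::int))"
    using cong_if_add_multiple [OF eq] by (simp add: cong_sym)
  then have "even z"
    by (rule even_exponent_if_order_two [rotated 2]) (simp_all add: cong_def)
  then obtain Z where "z = 2 * Z" by blast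
  then show False
    using difference_of_squares_20 [of 1 x N Z] assms by simp
qed

text \<open>The disjunction comes from \<open>k ^ (z - y) = 1\<close>.\<close>

lemma no_solution_w_99:
  fixes N :: int
  assumes eq: "99 ^ y + 20 ^ x * N = 101 ^ z" and "N > 0" "0 < y" "z < x" "N = 1 \<or> y = z"
  shows False
proof -
  have "[99 ^ y = 101 ^ z] (mod (4::int))"
    using cong_if_add_multiple [OF eq] \<open>z < x\<close> by (simp add: dvd_power_le [of 4 20 1 x, simplified])
  moreover have "[101 ^ z = 1 ^ z] (mod (4::int))"
    by (rule cong_pow) (simp add: cong_def)
  ultimately have "[99 ^ y = 1] (mod (4::int))"
    by (metis cong_trans power_one)
  then have "even y"
    by (rule even_exponent_if_order_two [rotated 2]) (simp_all add: cong_def)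
  then obtain Y where Y: "y = 2 * Y" by blast
  \<comment> \<open>Either \<open>z\<close> inherits the parity of \<open>y\<close>, or
    \<open>N = 1\<close> and the equation modulo 11 applies, where 20 \<equiv> 3^2.\<close>
  have "even z"
  proof (cases "y = z")
    case True
    with \<open>even y\<close> show ?thesis by simp
  next
    case False
    then have "20 ^ x + 99 ^ y = (101::int) ^ z"
      using assms by simp
    then have "[20 ^ x = 101 ^ z] (mod (11::int))"
      by (rule cong_if_add_multiple)
        (use \<open>0 < y\<close> in \<open>simp add: dvd_power_le [of 11 99 1 y, simplified]\<close>)
    then show ?thesis
      by (rule even_exponent_if_quadratic_residue [rotated]) (simp add: cong_def)
  qed
  then obtain Z where Z: "z = 2 * Z" by blast
  \<comment> \<open>As 99 \<equiv> -1 modulo 20, the base -99 gives a root that is 1 modulo 20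
    whatever the parity of \<open>Y\<close>.\<close>
  have "[(- 99) ^ Y = 1 ^ Y] (mod (20::int))"
    by (rule cong_pow) (simp add: cong_def)
  moreover have "((- 99) ^ Y)\<^sup>2 = (99::int) ^ y"
    unfolding Y by (metis even_numeral power_even_eq power_minus_even power_mult)
  ultimately show False
    using difference_of_squares_20 [of "(- 99) ^ Y" x N Z] assms Z by simp
qed

text \<open>With \<open>y = 2 * Y\<close> and \<open>z = 2 * Z\<close>, the bound for 20 excludes
  even \<open>Y\<close>. For odd \<open>Y\<close> also \<open>Z\<close> is odd, and then all factors
  3 and 5 of (C - D) * (C + D) lie in \<open>C - D\<close>. So C + D \<le> 4^x < 5^x \<le> C - D,
  which is absurd.\<close>

lemma no_solution_w_11:
  assumes eq: "11 ^ y + 20 ^ x * 3 ^ m = (101::int) ^ z" and "m > 0" "0 < z" "z < x"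
  shows False
proof -
  have dvd20: "(20::int) ^ 2 dvd 20 ^ x"
    using assms by (intro le_imp_power_dvd) simp
  have "4 dvd (20::int) ^ x" "16 dvd (20::int) ^ x"
    by (rule dvd_trans [OF _ dvd20], simp)+
  then have w4: "[11 ^ y = 101 ^ z] (mod (4::int))" and w16: "[11 ^ y = 101 ^ z] (mod (16::int))"
    using cong_if_add_multiple [OF eq] by simp_all
  have w3: "[11 ^ y = 101 ^ z] (mod (3::int))"
    using cong_if_add_multiple [OF eq] \<open>m > 0\<close> by simp
  have "[101 ^ z = 1 ^ z] (mod (4::int))"
    by (rule cong_pow) (simp add: cong_def)
  with w4 have "[11 ^ y = 1] (mod (4::int))"
    by (metis cong_trans power_one)
  then have "even y"
    by (rule even_exponent_if_order_two [rotated 2]) (simp_all add: cong_def)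
  then obtain Y where Y: "y = 2 * Y" by blast
  have "[11 ^ y = 1] (mod (3::int))"
    using cong_power_periodic [of 11 2 3 Y 0] Y by (simp add: cong_def)
  with w3 have "[101 ^ z = 1] (mod (3::int))"
    by (metis cong_sym cong_trans)
  then have "even z"
    by (rule even_exponent_if_order_two [rotated 2]) (simp_all add: cong_def)
  then obtain Z where Z: "z = 2 * Z" by blast
  define C :: int where "C = 101 ^ Z"
  define D :: int where "D = 11 ^ Y"
  have "odd Y"
  proof
    assume "even Y"
    then have "[D = 1] (mod 20)"
      unfolding D_def using cong_power_periodic [of 11 2 20 _ 0] by (auto simp: cong_def elim!: evenE)
    then show False
      using difference_of_squares_20 [of D x "3 ^ m" Z] assms
      by (simp add: D_def Y Z mult.commute flip: power_mult)
  qed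
  then obtain j where j: "Y = 2 * j + 1" by (elim oddE)
  \<comment> \<open>Modulo 16, 11 and 101 both have order 4. Since \<open>Y\<close> is odd,
    \<open>11 ^ y\<close> is 11^2 \<equiv> 9, whereas even \<open>Z\<close> would make
    \<open>101 ^ z\<close> equal to 1.\<close>
  have "odd Z"
  proof
    assume "even Z"
    then obtain i where "Z = 2 * i" by blast
    then have "[101 ^ z = 1] (mod (16::int))"
      using cong_power_periodic [of 101 4 16 i 0] Z by (simp add: cong_def)
    moreover have "[11 ^ y = 11 ^ 2] (mod (16::int))"
      using cong_power_periodic [of 11 4 16 j 2] Y j by (simp add: cong_def)
    ultimately have "[11 ^ 2 = 1] (mod (16::int))"
      using w16 by (metis cong_sym cong_trans)
    then show False by (simp add: cong_def)
  qed
  then obtain i where i: "Z = 2 * i + 1" by (elim oddE)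
  have "D\<^sup>2 + 20 ^ x * 3 ^ m = C\<^sup>2"
    using eq by (simp add: C_def D_def Y Z mult.commute flip: power_mult)
  then have prod: "20 ^ x * 3 ^ m = (C - D) * (C + D)" and abs: "\<bar>D\<bar> < C"
    by (auto dest: square_add_eq_square simp: C_def)
  have "D > 0" by (simp add: D_def)
  \<comment> \<open>Both exponents are odd, so \<open>C\<close> and \<open>D\<close> are both -1
    modulo 3 and 3 does not divide their sum.\<close>
  have "[C = 101] (mod 3)" "[D = 11] (mod 3)"
    unfolding C_def D_def i j
    using cong_power_periodic [of 101 2 3 i 1] cong_power_periodic [of 11 2 3 j 1]
    by (simp_all add: cong_def)
  then have "[C + D = 101 + 11] (mod 3)"
    by (rule cong_add)
  then have "(C + D) mod 3 = 1"
    by (simp add: cong_def)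
  have "[C = 1 ^ Z] (mod 5)" "[D = 1 ^ Y] (mod 5)"
    unfolding C_def D_def by (rule cong_pow, simp add: cong_def)+
  then have "[C + D = 1 ^ Z + 1 ^ Y] (mod 5)"
    by (rule cong_add)
  then have "(C + D) mod 5 = 2"
    by (simp add: cong_def)
  have c3: "coprime (C + D) 3"
    using \<open>(C + D) mod 3 = 1\<close> by (metis coprime_mod_left_iff coprime_1_left zero_neq_numeral)
  have c5: "coprime (C + D) 5"
    using \<open>(C + D) mod 5 = 2\<close> prime_imp_coprime [of "5::int" "C + D"]
    by (simp add: coprime_commute dvd_eq_mod_eq_0)
  have "(20::int) ^ x * 3 ^ m = 4 ^ x * (5 ^ x * 3 ^ m)"
    by (simp flip: power_mult_distrib)
  with prod have prod': "4 ^ x * (5 ^ x * 3 ^ m) = (C - D) * (C + D)"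
    by simp
  have "C + D dvd 4 ^ x"
    using dvd_triv_right [of "C + D" "C - D"] c3 c5
    unfolding prod' [symmetric] by (subst (asm) coprime_dvd_mult_left_iff) simp_all
  then have "C + D \<le> 4 ^ x"
    by (simp add: zdvd_imp_le)
  have "5 ^ x dvd (C - D) * (C + D)"
    by (metis prod' dvd_triv_left dvd_mult)
  then have "5 ^ x dvd C - D"
    using c5 by (simp add: coprime_dvd_mult_left_iff coprime_commute)
  then have "5 ^ x \<le> C - D"
    using abs by (simp add: zdvd_imp_le)
  moreover have "(4::int) ^ x < 5 ^ x"
    using \<open>z < x\<close> by (simp add: power_strict_mono)
  ultimately show False
    using \<open>C + D \<le> 4 ^ x\<close> \<open>D > 0\<close> by linarith
qed

text \<open>The bound for 20 excludes even \<open>Y\<close>. For odd \<open>Y\<close>, congruences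
  modulo 16, 5 and 11 force C + D = 2 * 5^x with 5^x \<equiv> 1 modulo 8. Then \<open>x\<close> is
  even and C + D \<equiv> 2 modulo 3, although C \<equiv> 1 and D \<equiv> 0 there.\<close>

lemma no_solution_w_9:
  assumes eq: "9 ^ y + 20 ^ x * 11 ^ m = (101::int) ^ z" and "m > 0" "0 < y" "0 < z" "z < x"
  shows False
proof -
  have w11: "[9 ^ y = 101 ^ z] (mod (11::int))"
    using cong_if_add_multiple [OF eq] \<open>m > 0\<close> by simp
  then have "even z"
    by (rule even_exponent_if_quadratic_residue [rotated]) (simp add: cong_def)
  then obtain Z where Z: "z = 2 * Z" by blast
  \<comment> \<open>\<open>z\<close> is even and positive, so \<open>x \<ge> 3\<close>; this makes
    modulus 32 available.\<close>
  have dvd20: "(20::int) ^ 3 dvd 20 ^ x"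
    using assms Z by (intro le_imp_power_dvd) simp
  have "5 dvd (20::int) ^ x" "16 dvd (20::int) ^ x" "32 dvd (20::int) ^ x"
    by (rule dvd_trans [OF _ dvd20], simp)+
  then have w5: "[9 ^ y = 101 ^ z] (mod (5::int))"
    and w16: "[9 ^ y = 101 ^ z] (mod (16::int))" and w32: "[9 ^ y = 101 ^ z] (mod (32::int))"
    using cong_if_add_multiple [OF eq] by simp_all
  have "[101 ^ z = 1 ^ z] (mod (5::int))"
    by (rule cong_pow) (simp add: cong_def)
  with w5 have "[9 ^ y = 1] (mod (5::int))"
    by (metis cong_trans power_one)
  then have "even y"
    by (rule even_exponent_if_order_two [rotated 2]) (simp_all add: cong_def)
  then obtain Y where Y: "y = 2 * Y" by blast
  define C :: int where "C = 101 ^ Z"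
  define D :: int where "D = 9 ^ Y"
  have "odd Y"
  proof
    assume "even Y"
    then have "[D = 1] (mod 20)"
      unfolding D_def using cong_power_periodic [of 9 2 20 _ 0] by (auto simp: cong_def elim!: evenE)
    then show False
      using difference_of_squares_20 [of D x "11 ^ m" Z] assms
      by (simp add: D_def Y Z mult.commute flip: power_mult)
  qed
  then obtain j where j: "Y = 2 * j + 1" by (elim oddE)
  have "even Z"
  proof (rule ccontr)
    assume "odd Z"
    then obtain i where "Z = 2 * i + 1" by (elim oddE)
    then have "[101 ^ z = 101 ^ 2] (mod (16::int))"
      using cong_power_periodic [of 101 4 16 i 2] Z by (simp add: cong_def)
    moreover have "[9 ^ y = 1] (mod (16::int))"
      using cong_power_periodic [of 9 2 16 Y 0] Y by (simp add: cong_def)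
    ultimately have "[101 ^ 2 = 1] (mod (16::int))"
      using w16 by (metis cong_sym cong_trans)
    then show False by (simp add: cong_def)
  qed
  then obtain Z' where Z': "Z = 2 * Z'" by blast
  \<comment> \<open>Modulo 32, odd \<open>Y\<close> gives 9^2 \<equiv> 17 on the left, whereas even
    \<open>Z'\<close> would make 8 divide \<open>z\<close> and give 1 on the right.\<close>
  have "odd Z'"
  proof
    assume "even Z'"
    then obtain i where "Z' = 2 * i" by blast
    then have "[101 ^ z = 1] (mod (32::int))"
      using cong_power_periodic [of 101 8 32 i 0] Z Z' by (simp add: cong_def)
    moreover have "[9 ^ y = 9 ^ 2] (mod (32::int))"
      using cong_power_periodic [of 9 4 32 j 2] Y j by (simp add: cong_def)
    ultimately have "[9 ^ 2 = 1] (mod (32::int))"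
      using w32 by (metis cong_sym cong_trans)
    then show False by (simp add: cong_def)
  qed
  then obtain i where i: "Z' = 2 * i + 1" by (elim oddE)
  have "D\<^sup>2 + 20 ^ x * 11 ^ m = C\<^sup>2"
    using eq by (simp add: C_def D_def Y Z mult.commute flip: power_mult)
  then have prod: "20 ^ x * 11 ^ m = (C - D) * (C + D)" and abs: "\<bar>D\<bar> < C"
    by (auto dest: square_add_eq_square simp: C_def)
  have "[C = 101 ^ 2] (mod 16)" "[D = 9 ^ 1] (mod 16)"
    unfolding C_def D_def i j Z'
    using cong_power_periodic [of 101 4 16 i 2] cong_power_periodic [of 9 2 16 j 1]
    by (simp_all add: cong_def)
  then have "[C + D = 101 ^ 2 + 9 ^ 1] (mod 16)"
    by (rule cong_add)
  then have m16: "(C + D) mod 16 = 2"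
    by (simp add: cong_def)
  have "[C = 1 ^ Z] (mod 5)"
    unfolding C_def by (rule cong_pow) (simp add: cong_def)
  moreover have "[D = 9 ^ 1] (mod 5)"
    unfolding D_def j using cong_power_periodic [of 9 2 5 j 1] by (simp add: cong_def)
  ultimately have "[2 * (C - D) = 2 * (1 ^ Z - 9 ^ 1)] (mod 5)"
    by (intro cong_mult cong_diff cong_refl)
  then have m5: "(2 * (C - D)) mod 5 = 4"
    by (simp add: cong_def)
  have "[C = 101 ^ 0] (mod 3)"
    unfolding C_def Z' using cong_power_periodic [of 101 2 3 Z' 0] by (simp add: cong_def)
  moreover have "[D = 0] (mod 3)"
    unfolding D_def j by (simp add: cong_0_iff)
  ultimately have "[C + D = 101 ^ 0 + 0] (mod 3)"
    by (rule cong_add)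
  then have m3: "(C + D) mod 3 = 1"
    by (simp add: cong_def)
  \<comment> \<open>\<open>C\<close> and \<open>D\<close> are both nonzero squares modulo 11, while
    -1 is a non-residue.\<close>
  have n11: "\<not> 11 dvd C + D"
  proof
    assume "11 dvd C + D"
    then have "[- D = C] (mod 11)"
      by (simp add: cong_iff_dvd_diff dvd_diff_commute)
    then have "[(- D) ^ 5 = C ^ 5] (mod 11)"
      by (rule cong_pow)
    then have "[- (D ^ 5) = C ^ 5] (mod 11)"
      by simp
    moreover have "[C ^ 5 = 1] (mod 11)"
      using cong_power_periodic [of 101 10 11 Z' 0]
      by (simp add: C_def Z' cong_def mult.commute flip: power_mult)
    moreover have "[D ^ 5 = 1] (mod 11)"
      using cong_power_periodic [of 9 5 11 Y 0]
      by (simp add: D_def cong_def mult.commute flip: power_mult)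
    ultimately have "[- 1 = 1] (mod (11::int))"
      by (metis cong_minus_minus_iff cong_sym cong_trans)
    then show False by (simp add: cong_def)
  qed
  define P where "P = 8 * ((C + D) div 16) + 1"
  have P: "C + D = 2 * P" "P mod 8 = 1"
    using m16 div_mult_mod_eq [of "C + D" 16] by (simp_all add: P_def)
  have "odd P" using P(2) by presburger
  then have c4: "coprime P (4 ^ x)"
    by (metis coprime_power_right_iff coprime_right_2_iff_odd mult_2 numeral_Bit0 power2_eq_square numeral_times_numeral)
  have c11: "coprime P 11"
    using n11 P(1) prime_imp_coprime [of "11::int" P] dvd_mult [of 11 P 2]
    by (auto simp: coprime_commute)
  have "(20::int) ^ x * 11 ^ m = 5 ^ x * (4 ^ x * 11 ^ m)"
    by (simp flip: power_mult_distrib add: mult.assoc [symmetric])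
  with prod P(1) have prod': "5 ^ x * (4 ^ x * 11 ^ m) = (2 * (C - D)) * P"
    by simp
  have "P dvd 5 ^ x"
    using dvd_triv_right [of P "2 * (C - D)"] c4 c11
    unfolding prod' [symmetric] by (subst (asm) coprime_dvd_mult_left_iff) simp_all
  \<comment> \<open>5 does not divide \<open>C - D\<close>, so \<open>P\<close> absorbs all of
    \<open>5 ^ x\<close>.\<close>
  have "coprime 5 (2 * (C - D))"
    using m5 by (intro prime_imp_coprime) (simp_all add: dvd_eq_mod_eq_0 del: mod_0_imp_dvd)
  then have "coprime (2 * (C - D)) (5 ^ x)"
    by (metis coprime_commute coprime_power_left_iff)
  then have "5 ^ x dvd P"
    using prod' by (metis coprime_commute coprime_dvd_mult_right_iff dvd_triv_left)
  have "P > 0"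
    using P(1) abs by linarith
  with \<open>P dvd 5 ^ x\<close> \<open>5 ^ x dvd P\<close> have P5: "P = 5 ^ x"
    by (simp add: zdvd_antisym_nonneg)
  have "[5 ^ x = 1] (mod (8::int))"
    using P(2) P5 by (simp add: cong_def)
  then have "even x"
    by (rule even_exponent_if_order_two [rotated 2]) (simp_all add: cong_def)
  then have "[5 ^ x = 1] (mod (3::int))"
    using cong_power_periodic [of 5 2 3 _ 0] by (auto simp: cong_def elim!: evenE)
  then have "P mod 3 = 1"
    using P5 by (simp add: cong_def)
  then have "[2 * P = 2 * 1] (mod 3)"
    by (intro cong_mult cong_refl) (simp add: cong_def)
  with m3 P(1) show False
    by (simp add: cong_def)
qed

section \<open>Cancelling powers of \<open>k\<close>\<close>

text \<open>The equation has been divided by \<open>k ^ y\<close>; dividing further by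
  \<open>k ^ (z - y)\<close> leaves the cofactor \<open>w\<close> of that power in
  \<open>99 ^ y\<close>. A prime common to \<open>w\<close> and \<open>k\<close> would divide both
  101 and 99.\<close>

lemma no_solution_y_le_z_lt_x:
  fixes x y z k :: nat
  assumes eq: "20 ^ x * k ^ (x - y) + 99 ^ y = 101 ^ z * k ^ (z - y)"
    and "k > 0" "0 < y" "y \<le> z" "z < x"
  shows False
proof -
  have "k ^ (x - y) = k ^ (x - z) * k ^ (z - y)"
    using assms by (simp flip: power_add)
  with eq have eq1: "20 ^ x * k ^ (x - z) * k ^ (z - y) + 99 ^ y = 101 ^ z * k ^ (z - y)"
    by (simp add: mult.assoc)
  then have "k ^ (z - y) dvd 99 ^ y"
    by (metis dvd_add_right_iff dvd_triv_right)
  then obtain w where w: "w * k ^ (z - y) = 99 ^ y"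
    by (metis dvdE mult.commute)
  with eq1 have "(20 ^ x * k ^ (x - z) + w) * k ^ (z - y) = 101 ^ z * k ^ (z - y)"
    by (simp add: algebra_simps)
  then have eqw: "w + 20 ^ x * k ^ (x - z) = 101 ^ z"
    using \<open>k > 0\<close> by simp
  then have eqi: "int w + 20 ^ x * int k ^ (x - z) = 101 ^ z"
    using arg_cong [OF eqw, of int] by simp
  have "coprime w (k ^ (z - y))"
  proof (rule ccontr)
    assume "\<not> coprime w (k ^ (z - y))"
    then have "gcd w (k ^ (z - y)) \<noteq> 1"
      by (simp add: coprime_iff_gcd_eq_1)
    then obtain p where "prime p" "p dvd gcd w (k ^ (z - y))"
      using prime_factor_nat by blast
    then have p: "prime p" "p dvd w" "p dvd k ^ (z - y)"
      by simp_all
    then have "p dvd k"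
      using prime_dvd_power by blast
    then have "p dvd 101 ^ z"
      using p(2) \<open>z < x\<close> unfolding eqw [symmetric]
      by (metis dvd_add dvd_mult dvd_power dvd_trans zero_less_diff)
    then have "p dvd 101"
      using p(1) prime_dvd_power by blast
    moreover have "p dvd 99"
      using p(1,2) prime_dvd_power by (metis w dvd_mult2)
    ultimately have "p dvd 101 - 99" by (rule dvd_diff_nat)
    then have "p = 2"
      using p(1) by (simp add: primes_dvd_imp_eq)
    with \<open>p dvd 99\<close> show False by simp
  qed
  moreover have w': "w * k ^ (z - y) = 3 ^ (2 * y) * 11 ^ y"
    using w by (simp add: power_mult flip: power_mult_distrib)
  ultimately consider "w = 1" | "w = 9 ^ y" | "w = 11 ^ y" | "w = 99 ^ y"
    using coprime_factors_of_two_prime_powers [of 3 11 w "k ^ (z - y)" "2 * y" y]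
    by (auto simp: power_mult simp flip: power_mult_distrib)
  then show False
  proof cases
    case 1
    then show ?thesis
      using no_solution_w_1 [of x "int k ^ (x - z)" z] eqi assms by simp
  next
    case 2
    then have K: "k ^ (z - y) = 11 ^ y"
      using w' by (simp add: power_mult)
    \<comment> \<open>Since \<open>11 ^ y > 1\<close>, the exponent \<open>z - y\<close> is
      positive, so \<open>k\<close> itself is a power \<open>11 ^ s\<close> with
      \<open>s > 0\<close>. This yields the positive exponent \<open>s * (x - z)\<close>.\<close>
    then have "z \<noteq> y"
      using \<open>0 < y\<close> by (auto dest: sym)
    then have "k dvd 11 ^ y"
      using \<open>y \<le> z\<close> by (simp flip: K)
    then obtain s where s: "k = 11 ^ s"
      using divides_primepow_nat [of 11 k y] by auto
    with K \<open>0 < y\<close> have "s > 0"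
      by (cases "s = 0") (auto dest: sym)
    then show ?thesis
      using no_solution_w_9 [of y x "s * (x - z)" z] eqi assms 2 s by (simp add: power_mult)
  next
    case 3
    then have K: "k ^ (z - y) = 3 ^ (2 * y)"
      using w' by simp
    then have "z \<noteq> y"
      using \<open>0 < y\<close> by (auto dest: sym)
    then have "k dvd 3 ^ (2 * y)"
      using \<open>y \<le> z\<close> by (simp flip: K)
    then obtain s where s: "k = 3 ^ s"
      using divides_primepow_nat [of 3 k "2 * y"] by auto
    with K \<open>0 < y\<close> have "s > 0"
      by (cases "s = 0") (auto dest: sym)
    then show ?thesis
      using no_solution_w_11 [of y x "s * (x - z)" z] eqi assms 3 s by (simp add: power_mult)
  next
    case 4
    then have "k ^ (z - y) = 1"
      using w by simp
    then have "k = 1 \<or> y = z"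
      using \<open>y \<le> z\<close> by auto
    then show ?thesis
      using no_solution_w_99 [of y x "int k ^ (x - z)" z] eqi assms 4 by auto
  qed
qed

lemma no_solution_x_le_z_lt_y:
  fixes x y z k :: nat
  assumes eq: "20 ^ x + 99 ^ y * k ^ (y - x) = 101 ^ z * k ^ (z - x)"
    and "k > 0" "0 < x" "x \<le> z" "z < y"
  shows False
proof -
  have "k ^ (y - x) = k ^ (y - z) * k ^ (z - x)"
    using assms by (simp flip: power_add)
  with eq have eq1: "20 ^ x + 99 ^ y * k ^ (y - z) * k ^ (z - x) = 101 ^ z * k ^ (z - x)"
    by (simp add: mult.assoc)
  then have "k ^ (z - x) dvd 20 ^ x"
    by (metis dvd_add_left_iff dvd_triv_right)
  then obtain w where w: "w * k ^ (z - x) = 20 ^ x"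
    by (metis dvdE mult.commute)
  with eq1 have "(w + 99 ^ y * k ^ (y - z)) * k ^ (z - x) = 101 ^ z * k ^ (z - x)"
    by (simp add: algebra_simps)
  then have eqw: "w + 99 ^ y * k ^ (y - z) = 101 ^ z"
    using \<open>k > 0\<close> by simp
  then have eqi: "int w + 99 ^ y * int k ^ (y - z) = 101 ^ z"
    using arg_cong [OF eqw, of int] by simp
  have "coprime w (k ^ (z - x))"
  proof (rule ccontr)
    assume "\<not> coprime w (k ^ (z - x))"
    then have "gcd w (k ^ (z - x)) \<noteq> 1"
      by (simp add: coprime_iff_gcd_eq_1)
    then obtain p where "prime p" "p dvd gcd w (k ^ (z - x))"
      using prime_factor_nat by blast
    then have p: "prime p" "p dvd w" "p dvd k ^ (z - x)"
      by simp_all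
    then have "p dvd k"
      using prime_dvd_power by blast
    then have "p dvd 101 ^ z"
      using p(2) \<open>z < y\<close> unfolding eqw [symmetric]
      by (metis dvd_add dvd_mult dvd_power dvd_trans zero_less_diff)
    then have "p dvd 101"
      using p(1) prime_dvd_power by blast
    moreover have "p dvd 20"
      using p(1,2) prime_dvd_power by (metis w dvd_mult2)
    \<comment> \<open>100 and 101 are consecutive, so no prime divides both.\<close>
    then have "p dvd 5 * 20"
      by (rule dvd_mult)
    ultimately have "p dvd 101 - 5 * 20" by (rule dvd_diff_nat)
    then show False
      using p(1) by simp
  qed
  moreover have "w * k ^ (z - x) = 2 ^ (2 * x) * 5 ^ x"
    using w by (simp add: power_mult flip: power_mult_distrib)
  ultimately have "w \<in> {1, 4 ^ x, 5 ^ x, 20 ^ x}"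
    using coprime_factors_of_two_prime_powers [of 2 5 w "k ^ (z - x)" "2 * x" x]
    by (auto simp: power_mult simp flip: power_mult_distrib)
  then have "int w \<in> {1, 4 ^ x, 5 ^ x, 20 ^ x}"
    by auto
  then show False
    using no_solution_y_gt_z eqi assms by (metis of_nat_0_less_iff zero_less_power)
qed

text \<open>Division by \<open>k ^ z\<close> leaves \<open>101 ^ z\<close> on the right, so both
  \<open>k\<close> and the cofactor \<open>S\<close> are powers of the prime 101. The exponent
  \<open>m\<close> of \<open>S\<close> is at most \<open>z\<close> and takes its place in the
  reduced equations.\<close>

lemma no_solution_z_lt_both:
  fixes x y z k :: nat
  assumes eq: "(20 * k) ^ x + (99 * k) ^ y = (101 * k) ^ z"
    and "k > 0" "z < x" "z < y"
  shows False
proof -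
  define n where "n = min x y"
  define S where "S = 20 ^ x * k ^ (x - n) + 99 ^ y * k ^ (y - n)"
  have le: "n \<le> x" "n \<le> y" "z < n"
    using assms by (simp_all add: n_def)
  have "k ^ x = k ^ (x - n) * k ^ (n - z) * k ^ z" "k ^ y = k ^ (y - n) * k ^ (n - z) * k ^ z"
    using le by (simp_all flip: power_add)
  with eq have "k ^ (n - z) * S * k ^ z = 101 ^ z * k ^ z"
    by (simp add: S_def power_mult_distrib algebra_simps)
  then have kS: "k ^ (n - z) * S = 101 ^ z"
    using \<open>k > 0\<close> by simp
  then have "S dvd 101 ^ z"
    by (metis dvd_triv_right)
  then obtain m where m: "m \<le> z" "S = 101 ^ m"
    using divides_primepow_nat [of 101 S z] by auto
  show False
  proof (cases "x \<le> y")
    case True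
    then have "20 ^ x + 99 ^ y * k ^ (y - x) = 101 ^ m"
      using m(2) by (simp add: S_def n_def)
    from arg_cong [OF this, of int] have "20 ^ x + 99 ^ y * int k ^ (y - x) = 101 ^ m"
      by simp
    then show ?thesis
      using no_solution_y_gt_z [of "20 ^ x" x y "int k ^ (y - x)" m] m(1) assms by simp
  next
    case False
    then have S: "20 ^ x * k ^ (x - y) + 99 ^ y = 101 ^ m"
      using m(2) by (simp add: S_def n_def)
    have "k dvd 101 ^ z"
      using kS le(3) by (metis dvd_mult2 dvd_power zero_less_diff)
    then obtain t where t: "k = 101 ^ t"
      using divides_primepow_nat [of 101 k z] by auto
    \<comment> \<open>\<open>S \<ge> 99 ^ y > 1\<close>; hence 101 divides \<open>S\<close>, which
      is needed when 101 also divides \<open>k\<close>.\<close>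
    have "m > 0"
      using S one_less_power [of "99::nat" y] \<open>z < y\<close> by (intro gr0I) simp
    show ?thesis
    proof (cases "t = 0")
      case True
      have "99 ^ y + 20 ^ x * 1 = (101::nat) ^ m"
        using S t True by simp
      from arg_cong [OF this, of int] have "99 ^ y + 20 ^ x * 1 = (101::int) ^ m"
        by simp
      then show ?thesis
        using no_solution_w_99 [of y x 1 m] m(1) \<open>z < x\<close> \<open>z < y\<close> by simp
    next
      case t0: False
      then have "101 dvd k"
        using t by simp
      then have "101 dvd 20 ^ x * k ^ (x - y)"
        using False by (metis dvd_mult dvd_power dvd_trans not_le zero_less_diff)
      moreover have "101 dvd 20 ^ x * k ^ (x - y) + 99 ^ y"
        using S \<open>m > 0\<close> by simp
      ultimately have "101 dvd (99::nat) ^ y"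
        by (simp add: dvd_add_right_iff)
      then have "101 dvd (99::nat)"
        using prime_dvd_power [of "101::nat" 99 y] by simp
      then show ?thesis by simp
    qed
  qed
qed

section \<open>Exponent \<open>z\<close> at least as large as both others, and the
  conclusion\<close>

text \<open>Replacing \<open>k ^ x\<close> and \<open>k ^ y\<close> by the larger
  \<open>k ^ z\<close> and cancelling it leaves 101^z \<le> 20^x + 99^y, which fails from
  \<open>z = 3\<close> on.\<close>

lemma pow_sum_le_imp_two:
  fixes x y z k :: nat
  assumes eq: "(20 * k) ^ x + (99 * k) ^ y = (101 * k) ^ z"
    and "k > 0" "0 < x" "0 < y" "x \<le> z" "y \<le> z"
  shows "x = 2 \<and> y = 2 \<and> z = 2"
proof -
  have x: "(20 * k) ^ x \<le> 20 ^ x * k ^ z" and y: "(99 * k) ^ y \<le> 99 ^ y * k ^ z"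
    using assms by (simp_all add: power_mult_distrib power_increasing)
  have "101 ^ z * k ^ z \<le> (20 ^ x + 99 ^ y) * k ^ z"
    using add_mono [OF x y] unfolding eq by (simp add: power_mult_distrib distrib_right)
  then have le: "101 ^ z \<le> 20 ^ x + (99::nat) ^ y"
    using \<open>k > 0\<close> by simp
  have "z \<le> 2"
  proof (rule ccontr)
    assume "\<not> z \<le> 2"
    \<comment> \<open>Splitting off cubes makes the comparison linear: 8000 + 970299 <
      1030301.\<close>
    then obtain i where i: "z = i + 3"
      by (metis add.commute le_Suc_ex not_less_eq_eq numeral_2_eq_2 numeral_3_eq_3)
    have "(20::nat) ^ x \<le> 20 ^ z" "(99::nat) ^ y \<le> 99 ^ z"
      using assms by (simp_all add: power_increasing)
    moreover have "(20::nat) ^ i \<le> 101 ^ i" "(99::nat) ^ i \<le> 101 ^ i"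
      by (simp_all add: power_mono)
    moreover have "(101::nat) ^ i > 0"
      by simp
    moreover have "(20::nat) ^ z = 8000 * 20 ^ i" "(99::nat) ^ z = 970299 * 99 ^ i"
      "(101::nat) ^ z = 1030301 * 101 ^ i"
      by (simp_all add: i power_add)
    ultimately show False
      using le by linarith
  qed
  with assms(3-6) have "x \<in> {1, 2}" "y \<in> {1, 2}" "z \<in> {1, 2}"
    by auto
  \<comment> \<open>The inequality leaves only (1,1,1) and (2,2,2); the first would give 119 * k =
    101 * k.\<close>
  with le eq \<open>k > 0\<close> assms(5,6) show ?thesis
    by auto
qed

theorem theorem6p1:
  fixes k :: nat
  assumes "k > 0"
  shows "{(x :: nat, y :: nat, z :: nat). x > 0 \<and> y > 0 \<and> z > 0 \<and>
            (20 * k) ^ x + (99 * k) ^ y = (101 * k) ^ z} = {(2, 2, 2)}"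
proof -
  have "x = 2 \<and> y = 2 \<and> z = 2"
    if pos: "x > 0" "y > 0" "z > 0" and eq: "(20 * k) ^ x + (99 * k) ^ y = (101 * k) ^ z" for x y z
  proof -
    consider "x \<le> z" "y \<le> z" | "z < x" "z < y" | "x \<le> z" "z < y" | "y \<le> z" "z < x"
      by linarith
    then show ?thesis
    proof cases
      case 1
      then show ?thesis
        using pow_sum_le_imp_two eq pos assms by blast
    next
      case 2
      then show ?thesis
        using no_solution_z_lt_both eq assms by blast
    next
      case 3
      then have "k ^ y = k ^ (y - x) * k ^ x" "k ^ z = k ^ (z - x) * k ^ x"
        by (simp_all flip: power_add)
      with eq have "(20 ^ x + 99 ^ y * k ^ (y - x)) * k ^ x = (101 ^ z * k ^ (z - x)) * k ^ x"
        by (simp add: power_mult_distrib algebra_simps)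
      then have "20 ^ x + 99 ^ y * k ^ (y - x) = 101 ^ z * k ^ (z - x)"
        using assms by simp
      then show ?thesis
        using no_solution_x_le_z_lt_y 3 pos assms by blast
    next
      case 4
      then have "k ^ x = k ^ (x - y) * k ^ y" "k ^ z = k ^ (z - y) * k ^ y"
        by (simp_all flip: power_add)
      with eq have "(20 ^ x * k ^ (x - y) + 99 ^ y) * k ^ y = (101 ^ z * k ^ (z - y)) * k ^ y"
        by (simp add: power_mult_distrib algebra_simps)
      then have "20 ^ x * k ^ (x - y) + 99 ^ y = 101 ^ z * k ^ (z - y)"
        using assms by simp
      then show ?thesis
        using no_solution_y_le_z_lt_x 4 pos assms by blast
    qed
  qed
  moreover have "(20 * k)\<^sup>2 + (99 * k)\<^sup>2 = (101 * k)\<^sup>2"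
    by (simp add: power_mult_distrib)
  ultimately show ?thesis
    by auto
qed

end
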